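(* Assume each $f_i:\mathbb R^d\to\mathbb R$ ($i=1,\dots,m$) is convex and twice differentiable, with $L_{1,i}$-Lipschitz gradient and $L_{2,i}$-Lipschitz Hessian (operator norm). Let $\varepsilon>0$ be the desired accuracy and let $D=\max\{\|x-x^*\|: f(x)\le f(\bar x^0)+\varepsilon\}$. Let $N$ be the total number of iterations, and let the Decentralized Cubic Newton algorithm (see context) be run with $L\ge\bar L_2$ and constant parameters $$\delta_{1,k}=\delta_1\ge\max_{0\le j\le N}\Delta_{1|\hat x,j},\qquad \delta_{2,k}=\delta_2\ge\max_{0\le j\le N}\Delta_{2|\hat x,j}.$$ Let the gradient and Hessian inexactness levels be chosen for every $k=0,\dots,N$ as $$\hat\Delta_{g|\hat x,k}=\hat\Delta_{g|\hat x}\le\tfrac{\sqrt2}{144}\tfrac{\varepsilon}{D},\qquad \hat\Delta_{H|\hat x,k}=\hat\Delta_{H|\hat x}\le\tfrac{\sqrt3}{72}\sqrt{\tfrac{\varepsilon(L+\bar L_2)}{D}}.$$ Depending on $\varepsilon$, choose the number of iterations $N$ and the iterate inexactness level $\hat\Delta_{\hat x,k}=\hat\Delta_{\hat x}$ ($k=0,\dots,N$) as follows. (1) If $\varepsilon\le 12(L+\bar L_2)D^3$, set $$N=\Big\lceil\sqrt{\tfrac{108(L+\bar L_2)D^3}{\varepsilon}}\Big\rceil-2,\qquad \hat\Delta_{\hat x}\le\min\Big\{\tfrac{\sqrt2\,\varepsilon}{288\bar L_1D},\ \tfrac{\sqrt{3\varepsilon(L+\bar L_2)}}{144\bar L_2\sqrt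 D},\ \tfrac{\sqrt\varepsilon}{3\sqrt{(L+\bar L_2)D}}\Big\}.$$ (2) Otherwise, if $\varepsilon>12(L+\bar L_2)D^3$, set $$N=1,\qquad \hat\Delta_{\hat x}\le\min\Big\{\tfrac{\sqrt2\,\varepsilon}{288\bar L_1D},\ \tfrac{\sqrt{3\varepsilon(L+\bar L_2)}}{144\bar L_2\sqrt D},\ \tfrac{\varepsilon^{1/3}}{(6(L+\bar L_2))^{1/3}},\ D\Big\}.$$ Set also $\gamma=\frac{\sqrt{(N+1)(N+2)}}{6D}$. Then after $N+1$ iterations the algorithm outputs an $\varepsilon$-solution, i.e. $f(\bar x^{N+1})-f(x^* )\le\varepsilon$.
   Context: Setting: $m$ nodes, $f=\frac1m\sum_{i=1}^m f_i$ on $\mathbb R^d$, $x^*$ a global minimizer of $f$. $\bar L_p=\frac1m\sum_{i=1}^m L_{p,i}$, $p=1,2$. $\|\cdot\|$ is the Euclidean norm, $\|\cdot\|_{\rm op}$ the operator norm. Consensus: there is a sequence of mixing matrices $W^k\in\mathbb R^{m\times m}$ with nonnegative entries, $W^k\mathbf 1=\mathbf 1$, $\mathbf 1^\top W^k=\mathbf 1^\top$. $\mathrm{Consensus}(\{u_j\}_{j=1}^m,T)$ stacks the $u_j^\top$ as rows of a matrix $U$ and multiplies it by a product of $T$ consecutive mixing matrices; node $i$ receives the $i$-th row. Hessians are flattened into vectors of $\mathbb R^{d^2}$. Decentralized Cubic Newton: given initial points $x_1^0,\dots,x_m^0$, a number $N$, $L>0$, $\gamma>0$, $\delta_{1,k},\delta_{2,k}\ge0$,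 and numbers of consensus rounds, for $k=0,\dots,N$ each node $i$: 1. obtains $\hat x_i^k$ as its output of Consensus applied to $\{x_j^k\}_j$; 2. obtains $\hat g_i(\hat x_i^k)$ and $\hat H_i(\hat x_i^k)$ as its outputs of Consensus applied to $\{\nabla f_j(\hat x_j^k)\}_j$ and $\{\nabla^2f_j(\hat x_j^k)\}_j$; 3. sets $x_i^{k+1}=\arg\min_{x}\hat\omega_i^k(x;\hat x_i^k)$, where $$\hat\omega_i^k(x;\hat x_i^k)=\langle\hat g_i(\hat x_i^k),x-\hat x_i^k\rangle+\tfrac12\langle\hat H_i(\hat x_i^k)(x-\hat x_i^k),x-\hat x_i^k\rangle+\tfrac{\delta_{1,k}}{2\gamma}+\tfrac{\gamma\delta_{1,k}+\delta_{2,k}}2\|x-\hat x_i^k\|^2+\tfrac L6\|x-\hat x_i^k\|^3.$$ $\bar x^k=\frac1m\sum_i x_i^k$. The inexactness (consensus error) levels are numbers such that $\max_i\|\hat x_i^k-\bar x^k\|\le\hat\Delta_{\hat x,k}$, $\max_i\|\hat g_i(\hat x_i^k)-\frac1m\sum_j\nabla f_j(\hat x_j^k)\|\le\hat\Delta_{g|\hat x,k}$, $\max_i\|\hat H_i(\hat x_i^k)-\frac1m\sum_j\nabla^2f_j(\hat x_j^k)\|_{\rm op}\le\hat\Delta_{H|\hat x,k}$. Aggregated errors: $\Delta_{1|\hat x,k}=\hat\Delta_{g|\hat x,k}+2\bar L_1\hat\Delta_{\hat x,k}$, $\Delta_{2|\hat x,k}=\hat\Delta_{H|\hat x,k}+2\bar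 L_2\hat\Delta_{\hat x,k}$.
   Formalization: Upper bounds δ₁ ≤ (√2/72)ε/D and δ₂ ≤ (√3/36)√(ε(L+L̄₂)/D) are added: for arbitrarily large δ₁ or δ₂ the steps vanish and the claim fails; the choice of each δ as the maximal aggregated error always meets these bounds. *)

theory Defs
  imports "HOL-Analysis.Analysis"
begin

definition node_avg :: "('m::finite \<Rightarrow> 'a::real_vector) \<Rightarrow> 'a" where
  "node_avg u = (1 / real CARD('m)) *\<^sub>R (\<Sum>i\<in>UNIV. u i)"

definition is_maximum :: "real \<Rightarrow> real set \<Rightarrow> bool" where
  "is_maximum b S \<longleftrightarrow> b \<in> S \<and> (\<forall>s\<in>S. s \<le> b)"

definition op_norm :: "real^'d^'d \<Rightarrow> real" where
  "op_norm A = onorm (\<lambda>v. A *v v)"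

text \<open>Convexity, gradient and Hessian data of the local functions. The last clause is the
  Lipschitz condition on the Hessian with respect to the operator norm (and not with respect to
  the norm of the type of matrices, which is the Frobenius norm).\<close>

definition smooth_convex ::
  "(real^'d \<Rightarrow> real) \<Rightarrow> (real^'d \<Rightarrow> real^'d) \<Rightarrow> (real^'d \<Rightarrow> real^'d^'d) \<Rightarrow> real \<Rightarrow> real \<Rightarrow> bool" where
  "smooth_convex f grad hess L1 L2 \<longleftrightarrow>
     convex_on UNIV f \<and>
     (\<forall>x. GDERIV f x :> grad x) \<and>
     (\<forall>x. (grad has_derivative (\<lambda>v. hess x *v v)) (at x)) \<and>
     L1-lipschitz_on UNIV grad \<and>
     (\<forall>x y. op_norm (hess x - hess y) \<le> L2 * norm (x - y))"

definition mixing_matrix :: "real^'m^'m \<Rightarrow> bool" where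
  "mixing_matrix W \<longleftrightarrow> (\<forall>i j. 0 \<le> W $ i $ j) \<and> W *v 1 = 1 \<and> 1 v* W = 1"

text \<open>Product of the \<open>T\<close> consecutive mixing matrices with indices \<open>s, \<dots>, s + T - 1\<close>; the matrix
  with the smallest index acts first.\<close>

fun mixing_prod :: "(nat \<Rightarrow> real^'m^'m) \<Rightarrow> nat \<Rightarrow> nat \<Rightarrow> real^'m^'m" where
  "mixing_prod W s 0 = mat 1"
| "mixing_prod W s (Suc T) = W (s + T) ** mixing_prod W s T"

definition consensus ::
  "(nat \<Rightarrow> real^'m^'m) \<Rightarrow> nat \<Rightarrow> nat \<Rightarrow> ('m \<Rightarrow> real^'n) \<Rightarrow> 'm \<Rightarrow> real^'n" where
  "consensus W s T u = (\<lambda>i. (mixing_prod W s T ** (\<chi> j. u j)) $ i)"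

definition flatten :: "real^'d^'d \<Rightarrow> real^('d \<times> 'd)" where
  "flatten A = (\<chi> p. A $ fst p $ snd p)"

definition unflatten :: "real^('d \<times> 'd) \<Rightarrow> real^'d^'d" where
  "unflatten v = (\<chi> a b. v $ (a, b))"

definition consensus_mat ::
  "(nat \<Rightarrow> real^'m^'m) \<Rightarrow> nat \<Rightarrow> nat \<Rightarrow> ('m \<Rightarrow> real^'d^'d) \<Rightarrow> 'm \<Rightarrow> real^'d^'d" where
  "consensus_mat W s T A = (\<lambda>i. unflatten (consensus W s T (\<lambda>j. flatten (A j)) i))"

definition cubic_model ::
  "real \<Rightarrow> real \<Rightarrow> real \<Rightarrow> real \<Rightarrow> real^'d \<Rightarrow> real^'d^'d \<Rightarrow> real^'d \<Rightarrow> real^'d \<Rightarrow> real" where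
  "cubic_model L \<gamma> \<delta>1 \<delta>2 g H xh x =
     inner g (x - xh) + (1/2) * inner (H *v (x - xh)) (x - xh)
     + \<delta>1 / (2 * \<gamma>) + (\<gamma> * \<delta>1 + \<delta>2) / 2 * (norm (x - xh))^2 + L / 6 * (norm (x - xh))^3"

text \<open>\<open>x\<close>, \<open>xh\<close>, \<open>gh\<close>, \<open>Hh\<close> form a run of the method for the iterations \<open>0, \<dots>, N\<close>. The functions
  \<open>sx, sg, sH\<close> give the index of the first mixing matrix used in each consensus call, and
  \<open>Tx, Tg, TH\<close> the numbers of consensus rounds.\<close>

definition decentralized_cubic_newton ::
  "(nat \<Rightarrow> real^'m^'m) \<Rightarrow> (nat \<Rightarrow> nat) \<Rightarrow> (nat \<Rightarrow> nat) \<Rightarrow> (nat \<Rightarrow> nat) \<Rightarrow>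
   (nat \<Rightarrow> nat) \<Rightarrow> (nat \<Rightarrow> nat) \<Rightarrow> (nat \<Rightarrow> nat) \<Rightarrow>
   ('m \<Rightarrow> real^'d \<Rightarrow> real^'d) \<Rightarrow> ('m \<Rightarrow> real^'d \<Rightarrow> real^'d^'d) \<Rightarrow>
   nat \<Rightarrow> real \<Rightarrow> real \<Rightarrow> (nat \<Rightarrow> real) \<Rightarrow> (nat \<Rightarrow> real) \<Rightarrow>
   (nat \<Rightarrow> 'm \<Rightarrow> real^'d) \<Rightarrow> (nat \<Rightarrow> 'm \<Rightarrow> real^'d) \<Rightarrow>
   (nat \<Rightarrow> 'm \<Rightarrow> real^'d) \<Rightarrow> (nat \<Rightarrow> 'm \<Rightarrow> real^'d^'d) \<Rightarrow> bool" where
  "decentralized_cubic_newton W sx Tx sg Tg sH TH grad hess N L \<gamma> \<delta>1 \<delta>2 x xh gh Hh \<longleftrightarrow>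
     (\<forall>k\<le>N. \<forall>i.
        xh k i = consensus W (sx k) (Tx k) (x k) i \<and>
        gh k i = consensus W (sg k) (Tg k) (\<lambda>j. grad j (xh k j)) i \<and>
        Hh k i = consensus_mat W (sH k) (TH k) (\<lambda>j. hess j (xh k j)) i \<and>
        is_arg_min (cubic_model L \<gamma> (\<delta>1 k) (\<delta>2 k) (gh k i) (Hh k i) (xh k i))
          (\<lambda>_. True) (x (Suc k) i))"

definition inexactness_levels ::
  "('m::finite \<Rightarrow> real^'d \<Rightarrow> real^'d) \<Rightarrow> ('m \<Rightarrow> real^'d \<Rightarrow> real^'d^'d) \<Rightarrow> nat \<Rightarrow>
   (nat \<Rightarrow> 'm \<Rightarrow> real^'d) \<Rightarrow> (nat \<Rightarrow> 'm \<Rightarrow> real^'d) \<Rightarrow>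
   (nat \<Rightarrow> 'm \<Rightarrow> real^'d) \<Rightarrow> (nat \<Rightarrow> 'm \<Rightarrow> real^'d^'d) \<Rightarrow>
   (nat \<Rightarrow> real) \<Rightarrow> (nat \<Rightarrow> real) \<Rightarrow> (nat \<Rightarrow> real) \<Rightarrow> bool" where
  "inexactness_levels grad hess N x xh gh Hh \<Delta>x \<Delta>g \<Delta>H \<longleftrightarrow>
     (\<forall>k\<le>N. \<forall>i.
        norm (xh k i - node_avg (x k)) \<le> \<Delta>x k \<and>
        norm (gh k i - node_avg (\<lambda>j. grad j (xh k j))) \<le> \<Delta>g k \<and>
        op_norm (Hh k i - node_avg (\<lambda>j. hess j (xh k j))) \<le> \<Delta>H k)"

definition agg_error :: "real \<Rightarrow> (nat \<Rightarrow> real) \<Rightarrow> (nat \<Rightarrow> real) \<Rightarrow> nat \<Rightarrow> real" where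
  "agg_error Lbar \<Delta>x \<Delta>loc k = \<Delta>loc k + 2 * Lbar * \<Delta>x k"

text \<open>Upper bounds on the iterate inexactness level, for the two ranges of the accuracy. They are
  extended reals because the second (or first) quotient imposes no restriction if its Lipschitz
  constant is 0 (the second one is 0 for instance for quadratic functions): on \<^typ>\<open>ereal\<close>, a
  positive number divided by 0 is \<open>\<infinity>\<close>, whereas on \<^typ>\<open>real\<close> it would be 0.\<close>

definition iterate_level_bound1 :: "real \<Rightarrow> real \<Rightarrow> real \<Rightarrow> real \<Rightarrow> real \<Rightarrow> ereal" where
  "iterate_level_bound1 \<epsilon> D L L1bar L2bar =
     Min {ereal (sqrt 2 * \<epsilon>) / ereal (288 * L1bar * D),
          ereal (sqrt (3 * \<epsilon> * (L + L2bar))) / ereal (144 * L2bar * sqrt D),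
          ereal (sqrt \<epsilon> / (3 * sqrt ((L + L2bar) * D)))}"

definition iterate_level_bound2 :: "real \<Rightarrow> real \<Rightarrow> real \<Rightarrow> real \<Rightarrow> real \<Rightarrow> ereal" where
  "iterate_level_bound2 \<epsilon> D L L1bar L2bar =
     Min {ereal (sqrt 2 * \<epsilon>) / ereal (288 * L1bar * D),
          ereal (sqrt (3 * \<epsilon> * (L + L2bar))) / ereal (144 * L2bar * sqrt D),
          ereal (root 3 \<epsilon> / root 3 (6 * (L + L2bar))),
          ereal D}"

end

theory Submission
  imports Defs
begin

text \<open>Write \<open>e\<^sub>k\<close> for the gap \<open>F (node_avg (x k)) - F xstar\<close> and \<open>M = L + L2bar\<close>. The averaged
  function \<open>F\<close> has Lipschitz gradient and Hessian with the averaged constants, and the vectors and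
  matrices that the nodes use differ from its gradient and Hessian at the local points by at most
  \<open>\<delta>1\<close> and \<open>\<delta>2\<close> (\<open>aggregated_gradient_error\<close>, \<open>aggregated_hessian_error\<close>). The cubic model of
  each node therefore majorizes \<open>F\<close>, and exceeds it at distance \<open>t\<close> from the local point by at
  most \<open>S t = \<delta>1 / \<gamma> + (\<gamma> \<delta>1 + \<delta>2) t\<^sup>2 + M t\<^sup>3 / 6\<close> (\<open>cubic_model_bounds\<close>). Comparing the minimizer
  of the model with a point on the segment from the average iterate to \<open>xstar\<close> and using convexity
  gives, for every \<open>\<alpha>\<close> in \<open>[0, 1]\<close>,
  \<open>e\<^sub>k\<^sub>+\<^sub>1 \<le> (1 - \<alpha>) e\<^sub>k + S (\<alpha> D + dx)\<close> (\<open>node_avg_step\<close>),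
  provided that the average iterate is within \<open>D\<close> of \<open>xstar\<close>.

  This recursion is used twice. The choice \<open>\<alpha> = 0\<close> shows that the gap never exceeds its initial
  value by more than \<open>(N + 1) S dx\<close>; this is at most \<open>\<epsilon>\<close>, so the iterates do not leave the level
  set that defines \<open>D\<close> (\<open>gap_drift\<close>). The choice \<open>\<alpha> = 3 / (k + 3)\<close> then gives the rate
  (\<open>gap_rate\<close>): the exact part of the error decays like \<open>M D\<^sup>3 / N\<^sup>2\<close>, which the number of iterations
  makes a fraction of \<open>\<epsilon>\<close>, the quadratic part like \<open>(\<gamma> \<delta>1 + \<delta>2) D\<^sup>2 / N\<close>, and the constant part
  \<open>S dx\<close> is multiplied by about \<open>N\<close>. The parameter \<open>\<gamma>\<close>, of order \<open>N / D\<close>, balances the two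
  contributions of \<open>\<delta>1\<close>, which are then of order \<open>\<delta>1 D\<close> whatever \<open>N\<close> is. That these fractions
  add up to at most \<open>\<epsilon>\<close> is \<open>small_accuracy_budget\<close>. If \<open>\<epsilon> > 12 M D\<^sup>3\<close>, already one step with
  \<open>\<alpha> = 1\<close> reaches the accuracy (\<open>large_accuracy_budget\<close>).\<close>

section \<open>Averages over the nodes\<close>

lemma node_avg_const: "node_avg (\<lambda>_::'m::finite. c) = c"
  by (simp add: node_avg_def sum_constant_scaleR)

lemma node_avg_diff: "node_avg u - node_avg v = node_avg (\<lambda>i. u i - v i)"
  by (simp add: node_avg_def sum_subtractf scaleR_diff_right)

lemma node_avg_mono:
  fixes a b :: "'m::finite \<Rightarrow> real"
  assumes "\<And>i. a i \<le> b i"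
  shows "node_avg a \<le> node_avg b"
  unfolding node_avg_def using assms by (intro scaleR_left_mono sum_mono) auto

lemma node_avg_mult_right:
  fixes a :: "'m::finite \<Rightarrow> real"
  shows "node_avg (\<lambda>i. a i * c) = node_avg a * c"
  by (simp add: node_avg_def sum_distrib_right)

lemma norm_node_avg_le:
  fixes u :: "'m::finite \<Rightarrow> 'a::real_normed_vector"
  shows "norm (node_avg u) \<le> node_avg (\<lambda>i. norm (u i))"
  unfolding node_avg_def by (simp add: divide_right_mono norm_sum)

lemma has_derivative_node_avg:
  fixes f :: "'m::finite \<Rightarrow> 'a::real_normed_vector \<Rightarrow> 'b::real_normed_vector"
  assumes "\<And>i. (f i has_derivative f' i) (at x)"
  shows "((\<lambda>y. node_avg (\<lambda>i. f i y)) has_derivative (\<lambda>h. node_avg (\<lambda>i. f' i h))) (at x)"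
  unfolding node_avg_def
  by (intro has_derivative_scaleR_right has_derivative_sum assms)

lemma convex_on_node_avg:
  fixes f :: "'m::finite \<Rightarrow> 'a::real_vector \<Rightarrow> real"
  assumes "\<And>i. convex_on S (f i)"
  shows "convex_on S (\<lambda>y. node_avg (\<lambda>i. f i y))"
proof -
  have S: "convex S"
    using assms convex_on_imp_convex by blast
  have "convex_on S (\<lambda>y. \<Sum>i\<in>I. f i y)" if "finite I" for I
    using that
  proof (induction I)
    case empty
    then show ?case using S by (simp add: convex_on_const)
  next
    case (insert i I)
    then show ?case using assms by (simp add: convex_on_add)
  qed
  then show ?thesis
    unfolding node_avg_def by (simp add: convex_on_cdiv)
qed

lemma convex_on_node_avg_le:
  fixes f :: "'a::real_vector \<Rightarrow> real" and u :: "'m::finite \<Rightarrow> 'a"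
  assumes "convex_on UNIV f"
  shows "f (node_avg u) \<le> node_avg (\<lambda>i. f (u i))"
proof -
  have "f (\<Sum>i\<in>UNIV. (1 / real CARD('m)) *\<^sub>R u i) \<le> (\<Sum>i\<in>UNIV. (1 / real CARD('m)) * f (u i))"
    by (rule convex_on_sum[OF _ _ assms]) auto
  then show ?thesis
    by (simp add: node_avg_def scaleR_sum_right sum_divide_distrib)
qed

section \<open>The operator norm\<close>

lemma norm_matrix_vector_le_op_norm: "norm (A *v v) \<le> op_norm A * norm v"
  unfolding op_norm_def by (intro onorm matrix_vector_mul_bounded_linear)

lemma op_norm_nonneg: "0 \<le> op_norm A"
  unfolding op_norm_def by (intro onorm_pos_le matrix_vector_mul_bounded_linear)

lemma op_norm_le:
  assumes "\<And>v. norm (A *v v) \<le> b * norm v"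
  shows "op_norm A \<le> b"
  unfolding op_norm_def using assms by (rule onorm_le)

lemma op_norm_triangle: "op_norm (A + B) \<le> op_norm A + op_norm B"
  unfolding op_norm_def matrix_vector_mult_add_rdistrib
  by (intro onorm_triangle matrix_vector_mul_bounded_linear)

lemma abs_quadratic_form_le_op_norm: "\<bar>(A *v v) \<bullet> v\<bar> \<le> op_norm A * (norm v)\<^sup>2"
proof -
  have "\<bar>(A *v v) \<bullet> v\<bar> \<le> norm (A *v v) * norm v"
    by (rule Cauchy_Schwarz_ineq2)
  also have "\<dots> \<le> op_norm A * norm v * norm v"
    by (intro mult_right_mono norm_matrix_vector_le_op_norm) auto
  finally show ?thesis
    by (simp add: power2_eq_square mult.assoc)
qed

lemma node_avg_matrix_vector_mult:
  fixes A :: "'m::finite \<Rightarrow> real^'d^'d"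
  shows "node_avg A *v v = node_avg (\<lambda>i. A i *v v)"
proof -
  have "(\<Sum>i\<in>I. A i) *v v = (\<Sum>i\<in>I. A i *v v)" if "finite I" for I
    using that by (induction I) (auto simp: matrix_vector_mult_add_rdistrib)
  then show ?thesis
    by (simp add: node_avg_def scaleR_matrix_vector_assoc[symmetric])
qed

lemma op_norm_node_avg_le:
  fixes A :: "'m::finite \<Rightarrow> real^'d^'d"
  shows "op_norm (node_avg A) \<le> node_avg (\<lambda>i. op_norm (A i))"
proof (rule op_norm_le)
  fix v :: "real^'d"
  have "norm (node_avg A *v v) \<le> node_avg (\<lambda>i. norm (A i *v v))"
    unfolding node_avg_matrix_vector_mult by (rule norm_node_avg_le)
  also have "\<dots> \<le> node_avg (\<lambda>i. op_norm (A i) * norm v)"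
    by (intro node_avg_mono norm_matrix_vector_le_op_norm)
  finally show "norm (node_avg A *v v) \<le> node_avg (\<lambda>i. op_norm (A i)) * norm v"
    by (simp add: node_avg_mult_right)
qed

section \<open>Convex functions with Lipschitz gradient and Hessian\<close>

text \<open>The space has positive dimension, so the Lipschitz condition can be tested on a pair of
  distinct points.\<close>

lemma smooth_convex_hess_const_nonneg:
  fixes f :: "real^'d \<Rightarrow> real"
  assumes "smooth_convex f grad hess L1 L2"
  shows "0 \<le> L2"
proof -
  have "op_norm (hess 1 - hess 0) \<le> L2 * norm (1 - 0 :: real^'d)"
    using assms unfolding smooth_convex_def by blast
  then have "0 \<le> L2 * norm (1 :: real^'d)"
    using op_norm_nonneg[of "hess 1 - hess 0"] by simp
  moreover have "norm (1 :: real^'d) > 0"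
    by (simp add: vec_eq_iff)
  ultimately show ?thesis
    by (simp add: zero_le_mult_iff)
qed

text \<open>The averaged objective is itself a function of the class to which the local functions belong,
  with the averaged constants. Everything about cubic steps can hence be said about one function.\<close>

lemma smooth_convex_node_avg:
  fixes f :: "'m::finite \<Rightarrow> real^'d \<Rightarrow> real"
  assumes f: "\<And>i. smooth_convex (f i) (grad i) (hess i) (L1 i) (L2 i)"
  shows "smooth_convex (\<lambda>y. node_avg (\<lambda>i. f i y)) (\<lambda>y. node_avg (\<lambda>i. grad i y))
           (\<lambda>y. node_avg (\<lambda>i. hess i y)) (node_avg L1) (node_avg L2)"
  unfolding smooth_convex_def
proof (intro conjI allI)
  show "convex_on UNIV (\<lambda>y. node_avg (\<lambda>i. f i y))"
    using f by (intro convex_on_node_avg) (auto simp: smooth_convex_def)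
next
  fix y
  have "((\<lambda>y. node_avg (\<lambda>i. f i y)) has_derivative (\<lambda>h. node_avg (\<lambda>i. h \<bullet> grad i y))) (at y)"
    using f by (intro has_derivative_node_avg) (auto simp: smooth_convex_def gderiv_def)
  moreover have "node_avg (\<lambda>i. h \<bullet> grad i y) = h \<bullet> node_avg (\<lambda>i. grad i y)" for h
    by (simp add: node_avg_def inner_sum_right)
  ultimately show "GDERIV (\<lambda>y. node_avg (\<lambda>i. f i y)) y :> node_avg (\<lambda>i. grad i y)"
    by (simp add: gderiv_def)
next
  fix y
  show "((\<lambda>y. node_avg (\<lambda>i. grad i y)) has_derivative (*v) (node_avg (\<lambda>i. hess i y))) (at y)"
    unfolding node_avg_matrix_vector_mult
    using f by (intro has_derivative_node_avg) (auto simp: smooth_convex_def)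
next
  have "norm (node_avg (\<lambda>i. grad i y) - node_avg (\<lambda>i. grad i z)) \<le> node_avg L1 * norm (y - z)" for y z
  proof -
    have "norm (node_avg (\<lambda>i. grad i y) - node_avg (\<lambda>i. grad i z))
        \<le> node_avg (\<lambda>i. norm (grad i y - grad i z))"
      unfolding node_avg_diff by (rule norm_node_avg_le)
    also have "\<dots> \<le> node_avg (\<lambda>i. L1 i * norm (y - z))"
      using f by (intro node_avg_mono) (auto simp: smooth_convex_def lipschitz_on_def dist_norm)
    finally show ?thesis
      by (simp add: node_avg_mult_right)
  qed
  moreover have "0 \<le> node_avg L1"
    using node_avg_mono[of "\<lambda>_. 0" L1] f
    by (auto simp: node_avg_const smooth_convex_def lipschitz_on_def)
  ultimately show "(node_avg L1)-lipschitz_on UNIV (\<lambda>y. node_avg (\<lambda>i. grad i y))"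
    by (auto simp: lipschitz_on_def dist_norm)
next
  fix y z
  have "op_norm (node_avg (\<lambda>i. hess i y) - node_avg (\<lambda>i. hess i z))
      \<le> node_avg (\<lambda>i. op_norm (hess i y - hess i z))"
    unfolding node_avg_diff by (rule op_norm_node_avg_le)
  also have "\<dots> \<le> node_avg (\<lambda>i. L2 i * norm (y - z))"
    using f by (intro node_avg_mono) (auto simp: smooth_convex_def)
  finally show "op_norm (node_avg (\<lambda>i. hess i y) - node_avg (\<lambda>i. hess i z))
      \<le> node_avg L2 * norm (y - z)"
    by (simp add: node_avg_mult_right)
qed

text \<open>Integrating the bound on the second derivative twice: \<open>\<phi>\<close> minus the cubic polynomial that
  majorizes it has a nonpositive derivative.\<close>

lemma taylor2_le:
  fixes \<phi> \<phi>1 \<phi>2 :: "real \<Rightarrow> real"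
  assumes d1: "\<And>t. (\<phi> has_real_derivative \<phi>1 t) (at t)"
    and d2: "\<And>t. (\<phi>1 has_real_derivative \<phi>2 t) (at t)"
    and bound: "\<And>t. 0 \<le> t \<Longrightarrow> \<phi>2 t \<le> \<phi>2 0 + c * t"
  shows "\<phi> 1 \<le> \<phi> 0 + \<phi>1 0 + \<phi>2 0 / 2 + c / 6"
proof -
  have first: "\<phi>1 t \<le> \<phi>1 0 + \<phi>2 0 * t + c * t^2 / 2" if "0 \<le> t" for t
  proof -
    have "\<phi>1 t - (\<phi>2 0 * t + c * t^2 / 2) \<le> \<phi>1 0 - (\<phi>2 0 * 0 + c * 0^2 / 2)"
    proof (rule DERIV_nonpos_imp_nonincreasing[OF that])
      fix s :: real assume "0 \<le> s"
      have "((\<lambda>t. \<phi>1 t - (\<phi>2 0 * t + c * t^2 / 2)) has_real_derivative (\<phi>2 s - (\<phi>2 0 + c * s))) (at s)"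
        by (auto intro!: derivative_eq_intros d2)
      then show "\<exists>y. ((\<lambda>t. \<phi>1 t - (\<phi>2 0 * t + c * t^2 / 2)) has_real_derivative y) (at s) \<and> y \<le> 0"
        using bound[OF \<open>0 \<le> s\<close>] by (intro exI[of _ "\<phi>2 s - (\<phi>2 0 + c * s)"]) auto
    qed
    then show ?thesis by simp
  qed
  have "\<phi> 1 - (\<phi>1 0 * 1 + \<phi>2 0 * 1^2 / 2 + c * 1^3 / 6) \<le> \<phi> 0 - (\<phi>1 0 * 0 + \<phi>2 0 * 0^2 / 2 + c * 0^3 / 6)"
  proof (rule DERIV_nonpos_imp_nonincreasing[where
        f = "\<lambda>t. \<phi> t - (\<phi>1 0 * t + \<phi>2 0 * t^2 / 2 + c * t^3 / 6)"])
    fix s :: real assume "0 \<le> s"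
    have "((\<lambda>t. \<phi> t - (\<phi>1 0 * t + \<phi>2 0 * t^2 / 2 + c * t^3 / 6)) has_real_derivative
            (\<phi>1 s - (\<phi>1 0 + \<phi>2 0 * s + c * s^2 / 2))) (at s)"
      by (auto intro!: derivative_eq_intros d1)
    then show "\<exists>y. ((\<lambda>t. \<phi> t - (\<phi>1 0 * t + \<phi>2 0 * t^2 / 2 + c * t^3 / 6)) has_real_derivative y) (at s) \<and> y \<le> 0"
      using first[OF \<open>0 \<le> s\<close>] by (intro exI[of _ "\<phi>1 s - (\<phi>1 0 + \<phi>2 0 * s + c * s^2 / 2)"]) auto
  qed simp
  then show ?thesis by simp
qed

text \<open>The one-dimensional bound applies to \<open>t \<mapsto> f (x + t d)\<close>, whose second derivative
  changes by at most \<open>L2 t \<parallel>d\<parallel>\<^sup>3\<close>, and to its negative.\<close>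

lemma smooth_convex_taylor2:
  fixes f :: "real^'d \<Rightarrow> real"
  assumes f: "smooth_convex f grad hess L1 L2"
  shows "\<bar>f (x + d) - (f x + grad x \<bullet> d + (hess x *v d) \<bullet> d / 2)\<bar> \<le> L2 / 6 * norm d ^ 3"
proof -
  define \<phi> where "\<phi> t = f (x + t *\<^sub>R d)" for t
  define \<phi>1 where "\<phi>1 t = grad (x + t *\<^sub>R d) \<bullet> d" for t
  define \<phi>2 where "\<phi>2 t = (hess (x + t *\<^sub>R d) *v d) \<bullet> d" for t
  have d1: "(\<phi> has_real_derivative \<phi>1 t) (at t)" for t
  proof -
    have "(f has_derivative (\<lambda>h. h \<bullet> grad (x + t *\<^sub>R d))) (at (x + t *\<^sub>R d))"
      using f by (auto simp: smooth_convex_def gderiv_def)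
    then have "((\<lambda>t. f (x + t *\<^sub>R d)) has_derivative (\<lambda>s. (s *\<^sub>R d) \<bullet> grad (x + t *\<^sub>R d))) (at t)"
      by (rule has_derivative_compose[rotated]) (auto intro!: derivative_eq_intros)
    then show ?thesis
      unfolding \<phi>_def \<phi>1_def has_field_derivative_def
      by (rule has_derivative_eq_rhs) (auto simp: inner_commute mult.commute)
  qed
  have d2: "(\<phi>1 has_real_derivative \<phi>2 t) (at t)" for t
  proof -
    have "(grad has_derivative (*v) (hess (x + t *\<^sub>R d))) (at (x + t *\<^sub>R d))"
      using f by (auto simp: smooth_convex_def)
    then have "((\<lambda>t. grad (x + t *\<^sub>R d)) has_derivative (\<lambda>s. hess (x + t *\<^sub>R d) *v (s *\<^sub>R d))) (at t)"
      by (rule has_derivative_compose[rotated]) (auto intro!: derivative_eq_intros)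
    then have "((\<lambda>t. grad (x + t *\<^sub>R d) \<bullet> d) has_derivative
                 (\<lambda>s. (hess (x + t *\<^sub>R d) *v (s *\<^sub>R d)) \<bullet> d)) (at t)"
      by (rule has_derivative_inner_left)
    then show ?thesis
      unfolding \<phi>1_def \<phi>2_def has_field_derivative_def
      by (rule has_derivative_eq_rhs) (auto simp: matrix_vector_mult_scaleR mult.commute)
  qed
  have hess: "\<bar>\<phi>2 t - \<phi>2 0\<bar> \<le> L2 * norm d ^ 3 * t" if "0 \<le> t" for t
  proof -
    have "\<bar>((hess (x + t *\<^sub>R d) - hess x) *v d) \<bullet> d\<bar> \<le> op_norm (hess (x + t *\<^sub>R d) - hess x) * (norm d)\<^sup>2"
      by (rule abs_quadratic_form_le_op_norm)
    also have "\<dots> \<le> (L2 * norm ((x + t *\<^sub>R d) - x)) * (norm d)\<^sup>2"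
      using f by (intro mult_right_mono) (unfold smooth_convex_def, blast, simp)
    finally show ?thesis
      using that by (simp add: \<phi>2_def matrix_vector_mult_diff_rdistrib inner_diff_left
          power2_eq_square power3_eq_cube mult_ac)
  qed
  have "\<phi> 1 \<le> \<phi> 0 + \<phi>1 0 + \<phi>2 0 / 2 + (L2 * norm d ^ 3) / 6"
  proof (rule taylor2_le[OF d1 d2])
    show "\<phi>2 t \<le> \<phi>2 0 + L2 * norm d ^ 3 * t" if "0 \<le> t" for t
      using hess[OF that] by linarith
  qed
  moreover have "- \<phi> 1 \<le> - \<phi> 0 + - \<phi>1 0 + - \<phi>2 0 / 2 + (L2 * norm d ^ 3) / 6"
  proof (rule taylor2_le[OF DERIV_minus[OF d1] DERIV_minus[OF d2]])
    show "- \<phi>2 t \<le> - \<phi>2 0 + L2 * norm d ^ 3 * t" if "0 \<le> t" for t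
      using hess[OF that] by linarith
  qed
  ultimately show ?thesis
    unfolding abs_le_iff by (simp add: \<phi>_def \<phi>1_def \<phi>2_def)
qed

section \<open>One inexact cubic Newton step\<close>

text \<open>The loss in one step, as a function of the distance \<open>t\<close> between the point with which the
  new iterate is compared and the centre of the cubic model. With
  \<open>c0 = \<delta>1 / \<gamma>\<close>, \<open>c2 = \<gamma> \<delta>1 + \<delta>2\<close> and \<open>c3 = (L + L2) / 6\<close> it bounds the gap between the
  model and the function.\<close>

definition step_error :: "real \<Rightarrow> real \<Rightarrow> real \<Rightarrow> real \<Rightarrow> real" where
  "step_error c0 c2 c3 t = c0 + c2 * t^2 + c3 * t^3"

lemma step_error_mono:
  assumes "0 \<le> c2" "0 \<le> c3" "0 \<le> s" "s \<le> t"
  shows "step_error c0 c2 c3 s \<le> step_error c0 c2 c3 t"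
  unfolding step_error_def using assms by (intro add_mono mult_left_mono power_mono) auto

text \<open>The regularization of the model pays for the inexact data. The gradient error contributes
  \<open>\<delta>1 n\<close> at distance \<open>n\<close>, which is covered by \<open>\<delta>1 / (2 \<gamma>) + \<gamma> \<delta>1 n\<^sup>2 / 2\<close>; the Hessian error
  contributes \<open>\<delta>2 n\<^sup>2 / 2\<close>, and the Taylor remainder \<open>L2 n\<^sup>3 / 6\<close>. So the model majorizes the
  function. In the other direction the same three errors and the three regularization terms add
  up, which gives twice the first two and the sum \<open>L + L2\<close> in the third.\<close>

lemma cubic_model_bounds:
  fixes F :: "real^'d \<Rightarrow> real"
  assumes F: "smooth_convex F G H L1 L2"
    and g: "norm (g - G xh) \<le> \<delta>1"
    and A: "op_norm (A - H xh) \<le> \<delta>2"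
    and \<gamma>: "\<gamma> > 0"
    and L: "L2 \<le> L"
  shows "F y \<le> F xh + cubic_model L \<gamma> \<delta>1 \<delta>2 g A xh y" (is ?upper)
    and "F xh + cubic_model L \<gamma> \<delta>1 \<delta>2 g A xh y
           \<le> F y + step_error (\<delta>1 / \<gamma>) (\<gamma> * \<delta>1 + \<delta>2) ((L + L2) / 6) (norm (y - xh))" (is ?lower)
proof -
  define d where "d = y - xh"
  define n where "n = norm d"
  have [simp]: "0 \<le> n"
    by (simp add: n_def)
  have "0 \<le> \<delta>1"
    using g norm_ge_zero order_trans by blast
  have "\<bar>(g - G xh) \<bullet> d\<bar> \<le> norm (g - G xh) * n"
    unfolding n_def by (rule Cauchy_Schwarz_ineq2)
  also have "\<dots> \<le> \<delta>1 * n"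
    using g by (intro mult_right_mono) auto
  finally have grad: "\<bar>g \<bullet> d - G xh \<bullet> d\<bar> \<le> \<delta>1 * n"
    by (simp add: inner_diff_left)
  \<comment> \<open>the arithmetic-geometric mean inequality \<open>2 \<gamma> n \<le> 1 + (\<gamma> n)\<^sup>2\<close>\<close>
  have "0 \<le> \<delta>1 / (2 * \<gamma>) * (1 - \<gamma> * n)^2"
    using \<open>0 \<le> \<delta>1\<close> \<gamma> by simp
  also have "\<dots> = \<delta>1 / (2 * \<gamma>) + \<gamma> * \<delta>1 / 2 * n^2 - \<delta>1 * n"
    using \<gamma> by (simp add: field_simps power2_eq_square)
  finally have young: "\<delta>1 * n \<le> \<delta>1 / (2 * \<gamma>) + \<gamma> * \<delta>1 / 2 * n^2"
    by simp
  have "\<bar>((A - H xh) *v d) \<bullet> d\<bar> \<le> op_norm (A - H xh) * n^2"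
    unfolding n_def by (rule abs_quadratic_form_le_op_norm)
  also have "\<dots> \<le> \<delta>2 * n^2"
    using A by (intro mult_right_mono) auto
  finally have hess: "\<bar>(A *v d) \<bullet> d - (H xh *v d) \<bullet> d\<bar> \<le> \<delta>2 * n^2"
    by (simp add: inner_diff_left matrix_vector_mult_diff_rdistrib)
  have taylor: "\<bar>F y - (F xh + G xh \<bullet> d + (H xh *v d) \<bullet> d / 2)\<bar> \<le> L2 / 6 * n^3"
    using smooth_convex_taylor2[OF F, of xh d] by (simp add: d_def n_def)
  have cubic: "L2 / 6 * n^3 \<le> L / 6 * n^3"
    using L by (intro mult_right_mono) auto
  have model: "cubic_model L \<gamma> \<delta>1 \<delta>2 g A xh y =
      g \<bullet> d + (A *v d) \<bullet> d / 2 + \<delta>1 / (2 * \<gamma>) + \<gamma> * \<delta>1 / 2 * n^2 + \<delta>2 * n^2 / 2 + L / 6 * n^3"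
    by (simp add: cubic_model_def d_def n_def field_simps)
  show ?upper
    using grad young hess taylor cubic unfolding model by linarith
  have "step_error (\<delta>1 / \<gamma>) (\<gamma> * \<delta>1 + \<delta>2) ((L + L2) / 6) n =
      2 * (\<delta>1 / (2 * \<gamma>)) + 2 * (\<gamma> * \<delta>1 / 2 * n^2) + \<delta>2 * n^2 + L / 6 * n^3 + L2 / 6 * n^3"
    using \<gamma> by (simp add: step_error_def field_simps)
  then show ?lower
    using grad young hess taylor unfolding model d_def[symmetric] n_def[symmetric] by linarith
qed

lemma cubic_step:
  fixes F :: "real^'d \<Rightarrow> real"
  assumes "smooth_convex F G H L1 L2" "norm (g - G xh) \<le> \<delta>1" "op_norm (A - H xh) \<le> \<delta>2"
    and "\<gamma> > 0" "L2 \<le> L"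
    and z: "is_arg_min (cubic_model L \<gamma> \<delta>1 \<delta>2 g A xh) (\<lambda>_. True) z"
  shows "F z \<le> F y + step_error (\<delta>1 / \<gamma>) (\<gamma> * \<delta>1 + \<delta>2) ((L + L2) / 6) (norm (y - xh))"
proof -
  have "F z \<le> F xh + cubic_model L \<gamma> \<delta>1 \<delta>2 g A xh z"
    by (rule cubic_model_bounds(1)[OF assms(1-5)])
  also have "\<dots> \<le> F xh + cubic_model L \<gamma> \<delta>1 \<delta>2 g A xh y"
    using z by (auto simp: is_arg_min_linorder)
  also have "\<dots> \<le> F y + step_error (\<delta>1 / \<gamma>) (\<gamma> * \<delta>1 + \<delta>2) ((L + L2) / 6) (norm (y - xh))"
    by (rule cubic_model_bounds(2)[OF assms(1-5)])
  finally show ?thesis .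
qed

text \<open>All nodes are compared with the same point \<open>y\<close> of the segment from \<open>v\<close> to \<open>w\<close>. Since \<open>v\<close> is
  within \<open>r\<close> of every centre, \<open>y\<close> is within \<open>\<alpha> D + r\<close> of it; convexity passes from the new
  local iterates to their average and from \<open>y\<close> to the two ends of the segment.\<close>

lemma node_avg_step:
  fixes F :: "'a::real_normed_vector \<Rightarrow> real" and z xh :: "'m::finite \<Rightarrow> 'a"
  assumes F: "convex_on UNIV F"
    and z: "\<And>i y. F (z i) \<le> F y + step_error c0 c2 c3 (norm (y - xh i))"
    and xh: "\<And>i. norm (xh i - v) \<le> r"
    and c: "0 \<le> c2" "0 \<le> c3"
    and \<alpha>: "0 \<le> \<alpha>" "\<alpha> \<le> 1"
    and D: "norm (v - w) \<le> D"
  shows "F (node_avg z) - F w \<le> (1 - \<alpha>) * (F v - F w) + step_error c0 c2 c3 (\<alpha> * D + r)"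
proof -
  define y where "y = (1 - \<alpha>) *\<^sub>R v + \<alpha> *\<^sub>R w"
  have "F (z i) \<le> F y + step_error c0 c2 c3 (\<alpha> * D + r)" for i
  proof -
    have "norm (y - xh i) = norm (\<alpha> *\<^sub>R (w - v) - (xh i - v))"
      by (simp add: y_def algebra_simps)
    also have "\<dots> \<le> norm (\<alpha> *\<^sub>R (w - v)) + norm (xh i - v)"
      by (rule norm_triangle_ineq4)
    also have "\<dots> \<le> \<alpha> * D + r"
      using \<alpha> D xh by (intro add_mono) (auto simp: norm_minus_commute mult_left_mono)
    finally show ?thesis
      using z[of i y] step_error_mono[OF c norm_ge_zero] by (meson add_left_mono order_trans)
  qed
  then have "node_avg (\<lambda>i. F (z i)) \<le> F y + step_error c0 c2 c3 (\<alpha> * D + r)"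
    using node_avg_mono[of "\<lambda>i. F (z i)" "\<lambda>_. F y + step_error c0 c2 c3 (\<alpha> * D + r)"]
    by (simp add: node_avg_const)
  moreover have "F (node_avg z) \<le> node_avg (\<lambda>i. F (z i))"
    using F by (rule convex_on_node_avg_le)
  moreover have "F y \<le> (1 - \<alpha>) * F v + \<alpha> * F w"
    using convex_onD[OF F \<alpha>] by (simp add: y_def)
  ultimately show ?thesis
    by (simp add: algebra_simps)
qed

text \<open>A node knows the average of gradients taken at different points \<open>xh j\<close>, while its model needs
  the gradient of the averaged function at its own point \<open>xh i\<close>. Any two of these points are at
  distance at most \<open>2 r\<close>, whence the second term of the aggregated error. The next lemma is the
  same for Hessians.\<close>

lemma aggregated_gradient_error:
  fixes grad :: "'m::finite \<Rightarrow> real^'d \<Rightarrow> real^'d"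
  assumes f: "\<And>j. smooth_convex (f j) (grad j) (hess j) (L1 j) (L2 j)"
    and xh: "\<And>j. norm (xh j - v) \<le> r"
    and g: "norm (g - node_avg (\<lambda>j. grad j (xh j))) \<le> b"
  shows "norm (g - node_avg (\<lambda>j. grad j (xh i))) \<le> b + 2 * node_avg L1 * r"
proof -
  have "norm (grad j (xh j) - grad j (xh i)) \<le> L1 j * (2 * r)" for j
  proof -
    have "norm (grad j (xh j) - grad j (xh i)) \<le> L1 j * norm (xh j - xh i)"
      using f[of j] by (auto simp: smooth_convex_def lipschitz_on_def dist_norm)
    also have "\<dots> \<le> L1 j * (2 * r)"
      using f[of j] norm_diff_triangle_le[OF xh[of j], of "xh i" r] xh[of i]
      by (intro mult_left_mono) (auto simp: smooth_convex_def lipschitz_on_def norm_minus_commute)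
    finally show ?thesis .
  qed
  then have "norm (node_avg (\<lambda>j. grad j (xh j)) - node_avg (\<lambda>j. grad j (xh i))) \<le> node_avg L1 * (2 * r)"
    unfolding node_avg_diff node_avg_mult_right[symmetric]
    by (intro order_trans[OF norm_node_avg_le] node_avg_mono)
  then show ?thesis
    using norm_diff_triangle_le[OF g] by (simp add: mult_ac)
qed

lemma aggregated_hessian_error:
  fixes hess :: "'m::finite \<Rightarrow> real^'d \<Rightarrow> real^'d^'d"
  assumes f: "\<And>j. smooth_convex (f j) (grad j) (hess j) (L1 j) (L2 j)"
    and xh: "\<And>j. norm (xh j - v) \<le> r"
    and A: "op_norm (A - node_avg (\<lambda>j. hess j (xh j))) \<le> b"
  shows "op_norm (A - node_avg (\<lambda>j. hess j (xh i))) \<le> b + 2 * node_avg L2 * r"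
proof -
  have "op_norm (hess j (xh j) - hess j (xh i)) \<le> L2 j * (2 * r)" for j
  proof -
    have "op_norm (hess j (xh j) - hess j (xh i)) \<le> L2 j * norm (xh j - xh i)"
      using f[of j] by (auto simp: smooth_convex_def)
    also have "\<dots> \<le> L2 j * (2 * r)"
      using smooth_convex_hess_const_nonneg[OF f, of j]
        norm_diff_triangle_le[OF xh[of j], of "xh i" r] xh[of i]
      by (intro mult_left_mono) (auto simp: norm_minus_commute)
    finally show ?thesis .
  qed
  then have "op_norm (node_avg (\<lambda>j. hess j (xh j)) - node_avg (\<lambda>j. hess j (xh i))) \<le> node_avg L2 * (2 * r)"
    unfolding node_avg_diff node_avg_mult_right[symmetric]
    by (intro order_trans[OF op_norm_node_avg_le] node_avg_mono)
  then show ?thesis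
    using A op_norm_triangle[of "A - node_avg (\<lambda>j. hess j (xh j))"
        "node_avg (\<lambda>j. hess j (xh j)) - node_avg (\<lambda>j. hess j (xh i))"]
    by (simp add: mult_ac)
qed

section \<open>The recursion for the optimality gap\<close>

text \<open>The method need not be monotone, and the bound on a step is only available while the iterate
  stays in a level set. It does stay there, because each step increases the gap by at most \<open>\<eta>\<close>
  and the total increase is within \<open>\<epsilon>\<close>.\<close>

lemma gap_drift:
  fixes e :: "nat \<Rightarrow> real"
  assumes step: "\<And>k. k \<le> N \<Longrightarrow> e k \<le> e 0 + \<epsilon> \<Longrightarrow> e (Suc k) \<le> e k + \<eta>"
    and \<eta>: "0 \<le> \<eta>" "real (N + 1) * \<eta> \<le> \<epsilon>"
    and k: "k \<le> N + 1"
  shows "e k \<le> e 0 + \<epsilon>"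
proof -
  have bound: "real k * \<eta> \<le> \<epsilon>" if "k \<le> N + 1" for k
  proof -
    have "real k * \<eta> \<le> real (N + 1) * \<eta>"
      using that \<eta>(1) by (intro mult_right_mono) auto
    then show ?thesis using \<eta>(2) by linarith
  qed
  have "e k \<le> e 0 + real k * \<eta>"
    using k
  proof (induction k)
    case (Suc k)
    then have "e k \<le> e 0 + real k * \<eta>"
      by simp
    then have "e (Suc k) \<le> e k + \<eta>"
      using bound[of k] Suc.prems by (intro step) auto
    then show ?case
      using \<open>e k \<le> e 0 + real k * \<eta>\<close> by (simp add: algebra_simps)
  qed simp
  then show ?thesis
    using bound[OF k] by linarith
qed

text \<open>This separates the contribution of the consensus error \<open>r\<close> from that of the move \<open>u\<close>
  towards the minimizer, by convexity of the square and of the cube.\<close>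

lemma step_error_add_le:
  assumes "0 \<le> c0" "0 \<le> c2" "0 \<le> c3" "0 \<le> u" "0 \<le> r"
  shows "step_error c0 c2 c3 (u + r) \<le> 4 * step_error c0 c2 c3 r + 2 * c2 * u^2 + 4 * c3 * u^3"
proof -
  have "(u + r)^2 \<le> 2 * u^2 + 2 * r^2"
    using zero_le_power2[of "u - r"] by (simp add: power2_eq_square algebra_simps)
  then have 2: "c2 * (u + r)^2 \<le> c2 * (2 * u^2 + 4 * r^2)"
    using assms by (intro mult_left_mono) (auto intro: order_trans)
  have "0 \<le> 3 * (u + r) * (u - r)^2"
    using assms by simp
  also have "\<dots> = 4 * u^3 + 4 * r^3 - (u + r)^3"
    by (simp add: power2_eq_square power3_eq_cube algebra_simps)
  finally have 3: "c3 * (u + r)^3 \<le> c3 * (4 * u^3 + 4 * r^3)"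
    using assms by (intro mult_left_mono) auto
  show ?thesis
    using 2 3 assms(1) by (simp add: step_error_def algebra_simps)
qed

text \<open>With \<open>\<alpha>\<^sub>k = 3 / (k + 3)\<close> the product of the factors \<open>1 - \<alpha>\<^sub>j\<close> decays like \<open>1 / k\<^sup>3\<close>:
  the weights \<open>k (k + 1) (k + 2)\<close> turn the recursion into a telescoping one, and the weighted
  terms with \<open>\<alpha>\<^sub>k\<^sup>2\<close> and \<open>\<alpha>\<^sub>k\<^sup>3\<close> are linear and constant in \<open>k\<close>. The initial
  gap has weight \<open>0\<close> and disappears. The constant error \<open>step_error c0 c2 c3 r\<close>, in contrast, is
  multiplied by about the number of steps.\<close>

lemma gap_rate:
  fixes e :: "nat \<Rightarrow> real"
  assumes step: "\<And>k \<alpha>. k \<le> N \<Longrightarrow> 0 \<le> \<alpha> \<Longrightarrow> \<alpha> \<le> 1 \<Longrightarrow>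
                   e (Suc k) \<le> (1 - \<alpha>) * e k + step_error c0 c2 c3 (\<alpha> * D + r)"
    and c: "0 \<le> c0" "0 \<le> c2" "0 \<le> c3" and D: "0 \<le> D" and r: "0 \<le> r"
  shows "e (N + 1) \<le> (real N + 4) * step_error c0 c2 c3 r + 9 * c2 * D^2 / (real N + 3)
           + 108 * c3 * D^3 / ((real N + 2) * (real N + 3))"
proof -
  define \<eta> where "\<eta> = step_error c0 c2 c3 r"
  \<comment> \<open>the sums over \<open>j < k\<close> of \<open>4 (j+1) (j+2) (j+3)\<close>, \<open>18 (j+1)\<close> and \<open>108\<close> in closed form\<close>
  have "real k * (real k + 1) * (real k + 2) * e k \<le>
          real k * (real k + 1) * (real k + 2) * (real k + 3) * \<eta>
          + 9 * (c2 * D^2) * (real k * (real k + 1)) + 108 * (c3 * D^3) * real k" if "k \<le> N + 1" for k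
    using that
  proof (induction k)
    case (Suc k)
    define q where "q = real k"
    have q: "0 \<le> q" by (simp add: q_def)
    define \<alpha> where "\<alpha> = 3 / (q + 3)"
    have \<alpha>: "0 \<le> \<alpha>" "\<alpha> \<le> 1"
      using q by (auto simp: \<alpha>_def)
    have q\<alpha>: "(q + 1) * \<alpha> \<le> 3" "(q + 2) * \<alpha> \<le> 3" "(q + 3) * \<alpha> \<le> 3"
      using q by (auto simp: \<alpha>_def field_simps)
    have "e (Suc k) \<le> (1 - \<alpha>) * e k + step_error c0 c2 c3 (\<alpha> * D + r)"
      using Suc.prems \<alpha> by (intro step) auto
    also have "step_error c0 c2 c3 (\<alpha> * D + r) \<le> 4 * \<eta> + 2 * c2 * (\<alpha> * D)^2 + 4 * c3 * (\<alpha> * D)^3"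
      unfolding \<eta>_def using c D r \<alpha> by (intro step_error_add_le) auto
    finally have "e (Suc k) \<le> (1 - \<alpha>) * e k + 4 * \<eta> + 2 * (c2 * D^2) * \<alpha>^2 + 4 * (c3 * D^3) * \<alpha>^3"
      by (simp add: power_mult_distrib mult_ac)
    then have "(q + 1) * (q + 2) * (q + 3) * e (Suc k) \<le> (q + 1) * (q + 2) * (q + 3) *
        ((1 - \<alpha>) * e k + 4 * \<eta> + 2 * (c2 * D^2) * \<alpha>^2 + 4 * (c3 * D^3) * \<alpha>^3)"
      using q by (intro mult_left_mono) auto
    also have "\<dots> = ((q + 3) * (1 - \<alpha>)) * (q + 1) * (q + 2) * e k + 4 * (q + 1) * (q + 2) * (q + 3) * \<eta>
        + (c2 * D^2) * (2 * (q + 1) * (q + 2) * (q + 3) * \<alpha>^2)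
        + (c3 * D^3) * (4 * (q + 1) * (q + 2) * (q + 3) * \<alpha>^3)"
      by (simp add: algebra_simps)
    also have "(q + 3) * (1 - \<alpha>) = q"
      using q by (simp add: \<alpha>_def field_simps)
    also have "(c2 * D^2) * (2 * (q + 1) * (q + 2) * (q + 3) * \<alpha>^2) \<le> (c2 * D^2) * (18 * (q + 1))"
    proof (rule mult_left_mono)
      have "2 * (q + 1) * (q + 2) * (q + 3) * \<alpha>^2 = 2 * (q + 1) * ((q + 2) * \<alpha>) * ((q + 3) * \<alpha>)"
        by (simp add: power2_eq_square)
      also have "\<dots> \<le> 2 * (q + 1) * 3 * 3"
        using q \<alpha> q\<alpha> by (intro mult_mono) auto
      finally show "2 * (q + 1) * (q + 2) * (q + 3) * \<alpha>^2 \<le> 18 * (q + 1)"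
        by simp
    qed (use c in simp)
    also have "(c3 * D^3) * (4 * (q + 1) * (q + 2) * (q + 3) * \<alpha>^3) \<le> (c3 * D^3) * 108"
    proof (rule mult_left_mono)
      have "4 * (q + 1) * (q + 2) * (q + 3) * \<alpha>^3 = 4 * ((q + 1) * \<alpha>) * ((q + 2) * \<alpha>) * ((q + 3) * \<alpha>)"
        by (simp add: power3_eq_cube)
      also have "\<dots> \<le> 4 * 3 * 3 * 3"
        using q \<alpha> q\<alpha> by (intro mult_mono) auto
      finally show "4 * (q + 1) * (q + 2) * (q + 3) * \<alpha>^3 \<le> 108"
        by simp
    qed (use c D in simp)
    finally have "(q + 1) * (q + 2) * (q + 3) * e (Suc k) \<le> q * (q + 1) * (q + 2) * e k
        + 4 * (q + 1) * (q + 2) * (q + 3) * \<eta> + c2 * D^2 * (18 * (q + 1)) + c3 * D^3 * 108"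
      by simp
    moreover have "q * (q + 1) * (q + 2) * e k \<le> q * (q + 1) * (q + 2) * (q + 3) * \<eta>
          + 9 * (c2 * D^2) * (q * (q + 1)) + 108 * (c3 * D^3) * q"
      using Suc by (simp add: q_def)
    ultimately have "(q + 1) * (q + 2) * (q + 3) * e (Suc k) \<le> (q + 1) * (q + 2) * (q + 3) * (q + 4) * \<eta>
          + 9 * (c2 * D^2) * ((q + 1) * (q + 2)) + 108 * (c3 * D^3) * (q + 1)"
      by (simp add: algebra_simps)
    then show ?case
      by (simp add: q_def algebra_simps)
  qed simp
  from this[of "N + 1"] have main: "(real N + 1) * ((real N + 2) * (real N + 3)) * e (N + 1) \<le>
      (real N + 1) * ((real N + 2) * (real N + 3) * (real N + 4) * \<eta>
          + 9 * (c2 * D^2) * (real N + 2) + 108 * (c3 * D^3))"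
    by (simp add: algebra_simps)
  then have "(real N + 2) * (real N + 3) * e (N + 1) \<le>
      (real N + 2) * (real N + 3) * (real N + 4) * \<eta> + 9 * (c2 * D^2) * (real N + 2) + 108 * (c3 * D^3)"
    by (simp add: mult.assoc)
  also have "\<dots> = (real N + 2) * (real N + 3) * ((real N + 4) * \<eta> + 9 * c2 * D^2 / (real N + 3)
           + 108 * c3 * D^3 / ((real N + 2) * (real N + 3)))"
    by (simp add: divide_simps) (simp add: algebra_simps)
  finally show ?thesis
    unfolding \<eta>_def[symmetric] by (subst (asm) mult_le_cancel_left_pos) auto
qed

section \<open>The parameter choices\<close>

text \<open>With \<open>s = sqrt (108 M D\<^sup>3 / \<epsilon>)\<close>, that is \<open>M = s\<^sup>2 \<epsilon> / (108 D\<^sup>3)\<close>, all the parameters become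
  monomials in \<open>\<epsilon>\<close>, \<open>D\<close> and \<open>s\<close>: \<open>\<delta>1 \<le> \<epsilon> / (50 D)\<close>, \<open>\<delta>2 \<le> s \<epsilon> / (216 D\<^sup>2)\<close>,
  \<open>r\<^sup>2 \<le> 12 D\<^sup>2 / s\<^sup>2\<close>, and \<open>\<gamma>\<close> is close to \<open>s / (6 D)\<close>, because \<open>N + 1 < s \<le> N + 2\<close>. In each
  estimate \<open>D\<close> then cancels, up to ratios like \<open>(N + 1) / s\<close> also \<open>s\<close>, and a fixed fraction of
  \<open>\<epsilon>\<close> remains. As \<open>\<epsilon> \<le> 12 M D\<^sup>3\<close> means \<open>s \<ge> 3\<close>, there are at least two steps and the
  roundings in \<open>N\<close> and \<open>\<gamma>\<close> cost only bounded factors.\<close>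

lemma small_accuracy_budget:
  fixes \<epsilon> D M \<gamma> \<delta>1 \<delta>2 r :: real and N :: nat
  assumes pos: "0 < \<epsilon>" "0 < D" "0 < M" and \<epsilon>: "\<epsilon> \<le> 12 * M * D^3"
    and N: "int N = \<lceil>sqrt (108 * M * D^3 / \<epsilon>)\<rceil> - 2"
    and \<gamma>: "\<gamma> = sqrt ((real N + 1) * (real N + 2)) / (6 * D)"
    and \<delta>1: "0 \<le> \<delta>1" "\<delta>1 \<le> sqrt 2 / 72 * (\<epsilon> / D)"
    and \<delta>2: "0 \<le> \<delta>2" "\<delta>2 \<le> sqrt 3 / 36 * sqrt (\<epsilon> * M / D)"
    and r: "0 \<le> r" "r \<le> sqrt \<epsilon> / (3 * sqrt (M * D))"
  shows "1 \<le> N"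
    and "real (N + 1) * step_error (\<delta>1 / \<gamma>) (\<gamma> * \<delta>1 + \<delta>2) (M / 6) r \<le> 3 / 10 * \<epsilon>"
    and "9 * (\<gamma> * \<delta>1 + \<delta>2) * D^2 / (real N + 3) \<le> 3 / 40 * \<epsilon>"
    and "108 * (M / 6) * D^3 / ((real N + 2) * (real N + 3)) \<le> \<epsilon> / 6"
proof -
  define s where "s = sqrt (108 * M * D^3 / \<epsilon>)"
  define p where "p = real N + 1"
  have s2: "s^2 = 108 * M * D^3 / \<epsilon>"
    using pos by (simp add: s_def)
  have "9 \<le> 108 * M * D^3 / \<epsilon>"
    using pos \<epsilon> by (simp add: field_simps)
  then have s3: "3 \<le> s"
    unfolding s_def by (intro real_le_rsqrt) simp
  have "real N + 2 = of_int \<lceil>s\<rceil>"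
    using N by (simp add: s_def)
  then have sp: "p < s" "s \<le> p + 1"
    unfolding p_def by linarith+
  show "1 \<le> N"
    using s3 sp unfolding p_def by linarith
  then have p2: "2 \<le> p"
    by (simp add: p_def)
  have M: "M = s^2 * \<epsilon> / (108 * D^3)"
    using pos by (simp add: s2)
  have pp: "p * (p + 1) / s^2 \<le> 4 / 3"
  proof -
    have "p * (p + 1) \<le> s * (4 / 3 * s)"
      using p2 sp s3 by (intro mult_mono) auto
    then show ?thesis
      using s3 by (simp add: field_simps power2_eq_square)
  qed
  have ps: "p / s \<le> 1"
    using sp s3 by simp

  have \<gamma>1: "p / (6 * D) \<le> \<gamma>" and \<gamma>2: "\<gamma> \<le> (p + 1) / (6 * D)"
  proof -
    have "sqrt (p * p) \<le> sqrt (p * (p + 1))" "sqrt (p * (p + 1)) \<le> sqrt ((p + 1) * (p + 1))"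
      using p2 by (intro real_sqrt_le_mono mult_left_mono mult_right_mono; simp)+
    then have "p \<le> sqrt (p * (p + 1))" "sqrt (p * (p + 1)) \<le> p + 1"
      using p2 by simp_all
    moreover have "\<gamma> = sqrt (p * (p + 1)) / (6 * D)"
      by (simp add: \<gamma> p_def add.commute)
    ultimately show "p / (6 * D) \<le> \<gamma>" "\<gamma> \<le> (p + 1) / (6 * D)"
      using pos by (simp_all add: divide_right_mono)
  qed
  have \<gamma>0: "0 < \<gamma>"
    using \<gamma>1 p2 pos by (smt (verit) divide_pos_pos)

  \<comment> \<open>\<open>36 / 25\<close> is chosen to make \<open>sqrt 2 / 72 \<le> 1 / 50\<close>\<close>
  have "sqrt 2 \<le> 36 / 25"
    by (intro real_le_lsqrt) (auto simp: power2_eq_square)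
  then have \<delta>1': "\<delta>1 \<le> \<epsilon> / (50 * D)"
    using \<delta>1(2) pos mult_right_mono[of "sqrt 2 / 72" "1 / 50" "\<epsilon> / D"] by simp
  have "sqrt 3 * sqrt (\<epsilon> * M / D) = s * \<epsilon> / (6 * D^2)"
  proof -
    have "sqrt 3 * sqrt (\<epsilon> * M / D) = sqrt ((s * \<epsilon> / (6 * D^2))^2)"
      unfolding real_sqrt_mult[symmetric] using pos
      by (intro arg_cong[of _ _ sqrt])
         (simp add: M power_mult_distrib power_divide power2_eq_square power3_eq_cube)
    then show ?thesis
      using pos s3 by simp
  qed
  then have \<delta>2': "\<delta>2 \<le> s * \<epsilon> / (216 * D^2)"
    using \<delta>2(2) by simp

  have r2: "r^2 \<le> 12 * D^2 / s^2"
  proof -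
    have "r^2 \<le> (sqrt \<epsilon> / (3 * sqrt (M * D)))^2"
      using r by (intro power_mono)
    also have "\<dots> = \<epsilon> / (9 * (M * D))"
      using pos by (simp add: power_divide power_mult_distrib)
    also have "\<dots> = 12 * D^2 / s^2"
      using pos s3 by (simp add: M field_simps power2_eq_square power3_eq_cube)
    finally show ?thesis .
  qed
  have r1: "r \<le> 7 / 2 * D / s"
  proof (rule power2_le_imp_le)
    have "12 * D^2 / s^2 \<le> (7 / 2 * D / s)^2"
    proof -
      have "12 * D^2 / s^2 \<le> (49 / 4 * D^2) / s^2"
        by (intro divide_right_mono) auto
      then show ?thesis
        by (simp add: power_divide power_mult_distrib)
    qed
    then show "r^2 \<le> (7 / 2 * D / s)^2"
      using r2 by linarith
  qed (use pos s3 in simp)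
  have r3: "r^3 \<le> 42 * D^3 / s^3"
  proof -
    have "r^3 = r^2 * r"
      by (simp add: power2_eq_square power3_eq_cube)
    also have "\<dots> \<le> (12 * D^2 / s^2) * (7 / 2 * D / s)"
      using r r1 r2 by (intro mult_mono) auto
    finally show ?thesis
      by (simp add: power2_eq_square power3_eq_cube)
  qed

  have \<gamma>\<delta>: "\<gamma> * \<delta>1 \<le> (p + 1) * \<epsilon> / (300 * D^2)"
  proof -
    have "\<gamma> * \<delta>1 \<le> (p + 1) / (6 * D) * (\<epsilon> / (50 * D))"
      using \<gamma>2 \<delta>1' \<delta>1 \<gamma>0 pos p2 by (intro mult_mono) auto
    then show ?thesis
      by (simp add: power2_eq_square)
  qed
  \<comment> \<open>the four terms of the constant error, accumulated over \<open>p = N + 1\<close> steps\<close>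
  have t0: "p * (\<delta>1 / \<gamma>) \<le> 3 / 25 * \<epsilon>"
  proof -
    have "p * (\<delta>1 / \<gamma>) = (p / \<gamma>) * \<delta>1"
      by simp
    also have "\<dots> \<le> (6 * D) * (\<epsilon> / (50 * D))"
      using \<gamma>1 \<gamma>0 \<delta>1' \<delta>1 pos by (intro mult_mono) (auto simp: field_simps)
    finally show ?thesis
      using pos by simp
  qed
  have t1: "p * (\<gamma> * \<delta>1 * r^2) \<le> 4 / 75 * \<epsilon>"
  proof -
    have "p * (\<gamma> * \<delta>1 * r^2) \<le> p * ((p + 1) * \<epsilon> / (300 * D^2) * (12 * D^2 / s^2))"
      using \<gamma>\<delta> r2 p2 pos by (intro mult_left_mono mult_mono) auto
    also have "\<dots> = p * (p + 1) / s^2 * (\<epsilon> / 25)"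
      using pos s3 by (simp add: divide_simps)
    also have "\<dots> \<le> 4 / 3 * (\<epsilon> / 25)"
      using pp pos by (intro mult_right_mono) auto
    finally show ?thesis
      by simp
  qed
  have t2: "p * (\<delta>2 * r^2) \<le> \<epsilon> / 18"
  proof -
    have "p * (\<delta>2 * r^2) \<le> p * (s * \<epsilon> / (216 * D^2) * (12 * D^2 / s^2))"
      using \<delta>2' r2 p2 pos s3 by (intro mult_left_mono mult_mono) auto
    also have "\<dots> = p / s * (\<epsilon> / 18)"
      using pos s3 by (simp add: field_simps power2_eq_square)
    also have "\<dots> \<le> 1 * (\<epsilon> / 18)"
      using ps pos by (intro mult_right_mono) auto
    finally show ?thesis
      by simp
  qed
  have t3: "p * (M / 6 * r^3) \<le> 7 / 108 * \<epsilon>"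
  proof -
    have "p * (M / 6 * r^3) \<le> p * (M / 6 * (42 * D^3 / s^3))"
      using r3 p2 pos by (intro mult_left_mono) auto
    also have "\<dots> = p / s * (7 / 108 * \<epsilon>)"
      using pos s3 by (simp add: M field_simps power2_eq_square power3_eq_cube)
    also have "\<dots> \<le> 1 * (7 / 108 * \<epsilon>)"
      using ps pos by (intro mult_right_mono) auto
    finally show ?thesis
      by simp
  qed
  have "real (N + 1) * step_error (\<delta>1 / \<gamma>) (\<gamma> * \<delta>1 + \<delta>2) (M / 6) r =
      p * (\<delta>1 / \<gamma>) + p * (\<gamma> * \<delta>1 * r^2) + p * (\<delta>2 * r^2) + p * (M / 6 * r^3)"
    by (simp add: step_error_def p_def algebra_simps)
  then show "real (N + 1) * step_error (\<delta>1 / \<gamma>) (\<gamma> * \<delta>1 + \<delta>2) (M / 6) r \<le> 3 / 10 * \<epsilon>"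
    using t0 t1 t2 t3 pos by linarith

  have "9 * (\<gamma> * \<delta>1 + \<delta>2) * D^2 \<le>
      9 * ((p + 1) * \<epsilon> / (300 * D^2) + (p + 1) * \<epsilon> / (216 * D^2)) * D^2"
  proof (intro mult_right_mono mult_left_mono add_mono \<gamma>\<delta>)
    have "s * \<epsilon> / (216 * D^2) \<le> (p + 1) * \<epsilon> / (216 * D^2)"
      using sp pos by (intro divide_right_mono mult_right_mono) auto
    then show "\<delta>2 \<le> (p + 1) * \<epsilon> / (216 * D^2)"
      using \<delta>2' by linarith
  qed auto
  also have "\<dots> = (p + 1) * ((3 / 100 + 1 / 24) * \<epsilon>)"
    using pos by (simp add: field_simps)
  also have "\<dots> \<le> (p + 2) * (3 / 40 * \<epsilon>)"
    using p2 pos by (intro mult_mono) auto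
  finally show "9 * (\<gamma> * \<delta>1 + \<delta>2) * D^2 / (real N + 3) \<le> 3 / 40 * \<epsilon>"
    by (simp add: p_def field_simps)

  have "108 * (M / 6) * D^3 = s^2 * (\<epsilon> / 6)"
    using pos by (simp add: M)
  also have "\<dots> \<le> ((p + 1) * (p + 2)) * (\<epsilon> / 6)"
    unfolding power2_eq_square using sp s3 pos by (intro mult_right_mono mult_mono) auto
  finally show "108 * (M / 6) * D^3 / ((real N + 2) * (real N + 3)) \<le> \<epsilon> / 6"
    by (subst pos_divide_le_eq) (auto simp: p_def mult_ac add_ac)
qed

text \<open>For a large accuracy a single step of length \<open>\<alpha> = 1\<close> from inside the level set suffices: it
  compares with the minimizer, which is within \<open>2 D\<close> of every centre, and all the errors at that
  distance already fit into \<open>\<epsilon>\<close>.\<close>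

lemma large_accuracy_budget:
  fixes \<epsilon> D M \<gamma> \<delta>1 \<delta>2 :: real
  assumes pos: "0 < \<epsilon>" "0 < D" "0 < M" and \<epsilon>: "12 * M * D^3 < \<epsilon>"
    and \<gamma>: "\<gamma> = sqrt 6 / (6 * D)"
    and \<delta>1: "0 \<le> \<delta>1" "\<delta>1 \<le> sqrt 2 / 72 * (\<epsilon> / D)"
    and \<delta>2: "0 \<le> \<delta>2" "\<delta>2 \<le> sqrt 3 / 36 * sqrt (\<epsilon> * M / D)"
  shows "step_error (\<delta>1 / \<gamma>) (\<gamma> * \<delta>1 + \<delta>2) (M / 6) (2 * D) \<le> \<epsilon>"
proof -
  have "sqrt 2 \<le> 36 / 25"
    by (intro real_le_lsqrt) (auto simp: power2_eq_square)
  then have \<delta>1': "\<delta>1 \<le> \<epsilon> / (50 * D)"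
    using \<delta>1(2) pos mult_right_mono[of "sqrt 2 / 72" "1 / 50" "\<epsilon> / D"] by simp
  have s6: "2 \<le> sqrt 6" "sqrt 6 \<le> 3"
    by (auto intro: real_le_lsqrt real_le_rsqrt)
  then have \<gamma>1: "1 / (3 * D) \<le> \<gamma>" and \<gamma>2: "\<gamma> \<le> 1 / (2 * D)"
    using pos by (auto simp: \<gamma> field_simps)
  have \<gamma>0: "0 < \<gamma>"
    using pos by (simp add: \<gamma>)
  have MD: "M * D^3 \<le> \<epsilon> / 12"
    using \<epsilon> by simp
  have "sqrt 3 * sqrt (\<epsilon> * M / D) \<le> \<epsilon> / (2 * D^2)"
  proof -
    have "\<epsilon> * (M * D^3) \<le> \<epsilon> * (\<epsilon> / 12)"
      using MD pos by (intro mult_left_mono) auto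
    then have "3 * (\<epsilon> * M / D) \<le> (\<epsilon> / (2 * D^2))^2"
      using pos by (simp add: field_simps power2_eq_square power3_eq_cube)
    then have "sqrt (3 * (\<epsilon> * M / D)) \<le> \<epsilon> / (2 * D^2)"
      using pos by (intro real_le_lsqrt) auto
    then show ?thesis
      by (simp only: real_sqrt_mult)
  qed
  then have \<delta>2': "\<delta>2 \<le> \<epsilon> / (72 * D^2)"
    using \<delta>2(2) by simp
  have "\<delta>1 / \<gamma> \<le> 3 / 50 * \<epsilon>"
  proof -
    have "(1 / \<gamma>) * \<delta>1 \<le> (3 * D) * (\<epsilon> / (50 * D))"
      using \<gamma>1 \<gamma>0 \<delta>1' \<delta>1 pos by (intro mult_mono) (auto simp: field_simps)
    then show ?thesis
      using pos by simp
  qed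
  moreover have "(\<gamma> * \<delta>1 + \<delta>2) * (2 * D)^2 \<le> (1 / 25 + 1 / 18) * \<epsilon>"
  proof -
    have "(\<gamma> * \<delta>1 + \<delta>2) * (2 * D)^2 \<le> (1 / (2 * D) * (\<epsilon> / (50 * D)) + \<epsilon> / (72 * D^2)) * (2 * D)^2"
      using \<gamma>2 \<gamma>0 \<delta>1 \<delta>1' \<delta>2' pos by (intro mult_right_mono add_mono mult_mono) auto
    also have "\<dots> = (1 / 25 + 1 / 18) * \<epsilon>"
      using pos by (simp add: field_simps power2_eq_square)
    finally show ?thesis .
  qed
  moreover have "M / 6 * (2 * D)^3 \<le> \<epsilon> / 9"
    using MD by (simp add: power_mult_distrib)
  ultimately have "step_error (\<delta>1 / \<gamma>) (\<gamma> * \<delta>1 + \<delta>2) (M / 6) (2 * D) \<le>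
      3 / 50 * \<epsilon> + (1 / 25 + 1 / 18) * \<epsilon> + \<epsilon> / 9"
    unfolding step_error_def by (intro add_mono)
  then show ?thesis
    using pos by simp
qed

section \<open>Convergence of the method\<close>

text \<open>The set \<open>{y. F y < F v + \<epsilon>}\<close> is open and not empty, so it is not contained in a single
  point.\<close>

lemma maximal_distance_pos:
  fixes F :: "real^'d \<Rightarrow> real"
  assumes F: "smooth_convex F G H L1 L2" and \<epsilon>: "0 < \<epsilon>"
    and D: "is_maximum D {norm (y - w) | y. F y \<le> F v + \<epsilon>}"
  shows "0 < D"
proof (rule ccontr)
  assume "\<not> 0 < D"
  have dist: "norm (y - w) \<le> D" if "F y \<le> F v + \<epsilon>" for y
    using D that by (auto simp: is_maximum_def)
  have "y = w" if "F y < F v + \<epsilon>" for y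
  proof -
    have "norm (y - w) \<le> 0"
      using dist[of y] that \<open>\<not> 0 < D\<close> by linarith
    then show ?thesis by simp
  qed
  then have "{y. F y < F v + \<epsilon>} \<subseteq> {w}"
    by blast
  moreover have "v \<in> {y. F y < F v + \<epsilon>}"
    using \<epsilon> by simp
  ultimately have "{y. F y < F v + \<epsilon>} = {w}"
    by blast
  moreover have "open {y. F y < F v + \<epsilon>}"
  proof (rule open_Collect_less)
    have "(F has_derivative (\<lambda>h. h \<bullet> G y)) (at y)" for y
      using F by (simp add: smooth_convex_def gderiv_def)
    then show "continuous_on UNIV F"
      by (meson continuous_at_imp_continuous_on has_derivative_continuous)
  qed (rule continuous_on_const)
  ultimately show False
    using not_open_singleton[of w] by simp
qed

theorem theorem1:
  fixes f :: "'m::finite \<Rightarrow> real^'d \<Rightarrow> real"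
    and grad :: "'m \<Rightarrow> real^'d \<Rightarrow> real^'d"
    and hess :: "'m \<Rightarrow> real^'d \<Rightarrow> real^'d^'d"
    and F :: "real^'d \<Rightarrow> real"
    and xstar :: "real^'d"
    and L1 L2 :: "'m \<Rightarrow> real"
    and L1bar L2bar L \<gamma> \<epsilon> D \<delta>1 \<delta>2 dx dg dH :: real
    and N :: nat
    and W :: "nat \<Rightarrow> real^'m^'m"
    and sx Tx sg Tg sH TH :: "nat \<Rightarrow> nat"
    and x xh gh :: "nat \<Rightarrow> 'm \<Rightarrow> real^'d"
    and Hh :: "nat \<Rightarrow> 'm \<Rightarrow> real^'d^'d"
    and \<Delta>x \<Delta>g \<Delta>H :: "nat \<Rightarrow> real"
  assumes f: "\<And>i. smooth_convex (f i) (grad i) (hess i) (L1 i) (L2 i)"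
    and F: "F = (\<lambda>y. node_avg (\<lambda>i. f i y))"
    and xstar: "\<And>y. F xstar \<le> F y"
    and L1bar: "L1bar = node_avg L1"
    and L2bar: "L2bar = node_avg L2"
    and \<epsilon>: "\<epsilon> > 0"
    and D: "is_maximum D {norm (y - xstar) | y. F y \<le> F (node_avg (x 0)) + \<epsilon>}"
    and W: "\<And>k. mixing_matrix (W k)"
    and L: "L > 0" "L \<ge> L2bar"
    and run: "decentralized_cubic_newton W sx Tx sg Tg sH TH grad hess N L \<gamma>
                (\<lambda>_. \<delta>1) (\<lambda>_. \<delta>2) x xh gh Hh"
    and levels: "inexactness_levels grad hess N x xh gh Hh \<Delta>x \<Delta>g \<Delta>H"
    and \<delta>1: "\<delta>1 \<ge> (MAX j\<in>{0..N}. agg_error L1bar \<Delta>x \<Delta>g j)"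
            "\<delta>1 \<le> sqrt 2 / 72 * (\<epsilon> / D)"
    and \<delta>2: "\<delta>2 \<ge> (MAX j\<in>{0..N}. agg_error L2bar \<Delta>x \<Delta>H j)"
            "\<delta>2 \<le> sqrt 3 / 36 * sqrt (\<epsilon> * (L + L2bar) / D)"
    and \<Delta>g: "\<And>k. k \<le> N \<Longrightarrow> \<Delta>g k = dg" "dg \<le> sqrt 2 / 144 * (\<epsilon> / D)"
    and \<Delta>H: "\<And>k. k \<le> N \<Longrightarrow> \<Delta>H k = dH" "dH \<le> sqrt 3 / 72 * sqrt (\<epsilon> * (L + L2bar) / D)"
    and \<Delta>x: "\<And>k. k \<le> N \<Longrightarrow> \<Delta>x k = dx"
    and case1: "\<epsilon> \<le> 12 * (L + L2bar) * D^3 \<Longrightarrow>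
                  int N = \<lceil>sqrt (108 * (L + L2bar) * D^3 / \<epsilon>)\<rceil> - 2 \<and>
                  ereal dx \<le> iterate_level_bound1 \<epsilon> D L L1bar L2bar"
    and case2: "\<epsilon> > 12 * (L + L2bar) * D^3 \<Longrightarrow>
                  N = 1 \<and> ereal dx \<le> iterate_level_bound2 \<epsilon> D L L1bar L2bar"
    and \<gamma>: "\<gamma> = sqrt ((real N + 1) * (real N + 2)) / (6 * D)"
  shows "F (node_avg (x (N + 1))) - F xstar \<le> \<epsilon>"
proof -
  define G where "G y = node_avg (\<lambda>i. grad i y)" for y
  define H where "H y = node_avg (\<lambda>i. hess i y)" for y
  have sF: "smooth_convex F G H L1bar L2bar"
    unfolding F G_def H_def L1bar L2bar by (rule smooth_convex_node_avg[OF f])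
  have D0: "0 < D"
    using maximal_distance_pos[OF sF \<epsilon> D] .
  have M0: "0 < L + L2bar"
    using L smooth_convex_hess_const_nonneg[OF sF] by linarith
  have \<gamma>0: "0 < \<gamma>"
    using D0 by (simp add: \<gamma>)
  have dx: "norm (xh k i - node_avg (x k)) \<le> dx" if "k \<le> N" for k i
    using levels that \<Delta>x by (auto simp: inexactness_levels_def)
  have dx0: "0 \<le> dx"
    using dx[of 0] norm_ge_zero order_trans by blast

  have g: "norm (gh k i - G (xh k i)) \<le> \<delta>1" if k: "k \<le> N" for k i
  proof -
    have "norm (gh k i - G (xh k i)) \<le> \<Delta>g k + 2 * node_avg L1 * dx"
      unfolding G_def
    proof (rule aggregated_gradient_error[OF f dx[OF k]])
      show "norm (gh k i - node_avg (\<lambda>j. grad j (xh k j))) \<le> \<Delta>g k"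
        using levels k by (auto simp: inexactness_levels_def)
    qed
    also have "\<dots> = agg_error L1bar \<Delta>x \<Delta>g k"
      using \<Delta>x k by (simp add: agg_error_def L1bar)
    also have "\<dots> \<le> (MAX j\<in>{0..N}. agg_error L1bar \<Delta>x \<Delta>g j)"
      using k by (intro Max_ge) auto
    finally show ?thesis
      using \<delta>1(1) by linarith
  qed
  have h: "op_norm (Hh k i - H (xh k i)) \<le> \<delta>2" if k: "k \<le> N" for k i
  proof -
    have "op_norm (Hh k i - H (xh k i)) \<le> \<Delta>H k + 2 * node_avg L2 * dx"
      unfolding H_def
    proof (rule aggregated_hessian_error[OF f dx[OF k]])
      show "op_norm (Hh k i - node_avg (\<lambda>j. hess j (xh k j))) \<le> \<Delta>H k"
        using levels k by (auto simp: inexactness_levels_def)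
    qed
    also have "\<dots> = agg_error L2bar \<Delta>x \<Delta>H k"
      using \<Delta>x k by (simp add: agg_error_def L2bar)
    also have "\<dots> \<le> (MAX j\<in>{0..N}. agg_error L2bar \<Delta>x \<Delta>H j)"
      using k by (intro Max_ge) auto
    finally show ?thesis
      using \<delta>2(1) by linarith
  qed
  have \<delta>0: "0 \<le> \<delta>1" "0 \<le> \<delta>2"
    using g[of 0] h[of 0] norm_ge_zero op_norm_nonneg order_trans by blast+

  \<comment> \<open>The recursion. Its hypothesis \<open>e k \<le> e 0 + \<epsilon>\<close> puts the average iterate into the level set
      on which the distance to the minimizer is at most \<open>D\<close>.\<close>
  define S where "S = step_error (\<delta>1 / \<gamma>) (\<gamma> * \<delta>1 + \<delta>2) ((L + L2bar) / 6)"
  define e where "e k = F (node_avg (x k)) - F xstar" for k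
  have c: "0 \<le> \<delta>1 / \<gamma>" "0 \<le> \<gamma> * \<delta>1 + \<delta>2" "0 \<le> (L + L2bar) / 6"
    using \<delta>0 \<gamma>0 M0 by auto
  have S_mono: "S s \<le> S t" if "0 \<le> s" "s \<le> t" for s t
    unfolding S_def by (rule step_error_mono[OF c(2,3) that])
  have S0: "0 \<le> S dx"
    unfolding S_def step_error_def using c dx0 by simp
  have step: "e (Suc k) \<le> (1 - \<alpha>) * e k + S (\<alpha> * D + dx)"
    if "k \<le> N" "e k \<le> e 0 + \<epsilon>" "0 \<le> \<alpha>" "\<alpha> \<le> 1" for k \<alpha>
    unfolding e_def S_def
  proof (rule node_avg_step[OF _ _ dx c(2,3)])
    show "convex_on UNIV F"
      using sF by (simp add: smooth_convex_def)
    show "F (x (Suc k) i) \<le> F y + step_error (\<delta>1 / \<gamma>) (\<gamma> * \<delta>1 + \<delta>2) ((L + L2bar) / 6) (norm (y - xh k i))"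
      for i y
    proof (rule cubic_step[OF sF g[OF that(1)] h[OF that(1)] \<gamma>0 L(2)])
      show "is_arg_min (cubic_model L \<gamma> \<delta>1 \<delta>2 (gh k i) (Hh k i) (xh k i)) (\<lambda>_. True) (x (Suc k) i)"
        by (rule run[unfolded decentralized_cubic_newton_def, rule_format, OF that(1), of i,
              THEN conjunct2, THEN conjunct2, THEN conjunct2])
    qed
    show "norm (node_avg (x k) - xstar) \<le> D"
      using D that(2) by (auto simp: is_maximum_def e_def)
  qed (use that in auto)
  \<comment> \<open>with \<open>\<alpha> = 0\<close> the new iterates are compared with the previous average\<close>
  have drift: "e k \<le> e 0 + \<epsilon>" if "real (N + 1) * S dx \<le> \<epsilon>" "k \<le> N + 1" for k
    using step[of _ 0] by (intro gap_drift[OF _ S0 that]) auto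

  have "e (N + 1) \<le> \<epsilon>"
  proof (cases "\<epsilon> \<le> 12 * (L + L2bar) * D^3")
    case True
    note case1 = case1[OF True]
    have N: "int N = \<lceil>sqrt (108 * (L + L2bar) * D^3 / \<epsilon>)\<rceil> - 2"
      using case1 by (rule conjunct1)
    have "iterate_level_bound1 \<epsilon> D L L1bar L2bar \<le> ereal (sqrt \<epsilon> / (3 * sqrt ((L + L2bar) * D)))"
      unfolding iterate_level_bound1_def by (rule Min_le; blast)
    with conjunct2[OF case1] have "ereal dx \<le> ereal (sqrt \<epsilon> / (3 * sqrt ((L + L2bar) * D)))"
      by (rule order_trans)
    then have dx': "dx \<le> sqrt \<epsilon> / (3 * sqrt ((L + L2bar) * D))"
      by (simp only: ereal_less_eq)
    note budget = small_accuracy_budget[OF \<epsilon> D0 M0 True N \<gamma> \<delta>0(1) \<delta>1(2) \<delta>0(2) \<delta>2(2) dx0 dx', folded S_def]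
    have "e (N + 1) \<le> (real N + 4) * S dx + 9 * (\<gamma> * \<delta>1 + \<delta>2) * D^2 / (real N + 3)
           + 108 * ((L + L2bar) / 6) * D^3 / ((real N + 2) * (real N + 3))"
      unfolding S_def
    proof (rule gap_rate[OF _ c])
      show "e (Suc k) \<le> (1 - \<alpha>) * e k
              + step_error (\<delta>1 / \<gamma>) (\<gamma> * \<delta>1 + \<delta>2) ((L + L2bar) / 6) (\<alpha> * D + dx)"
        if "k \<le> N" "0 \<le> \<alpha>" "\<alpha> \<le> 1" for k \<alpha>
        using step[of k \<alpha>] drift[of k] budget(2) \<epsilon> that by (simp add: S_def)
    qed (use D0 dx0 in auto)
    moreover have "(real N + 4) * S dx \<le> 5 / 2 * (real (N + 1) * S dx)"
    proof -
      have "(real N + 4) * S dx \<le> (5 / 2 * real (N + 1)) * S dx"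
        using budget(1) S0 by (intro mult_right_mono) auto
      then show ?thesis
        by (simp only: mult.assoc)
    qed
    \<comment> \<open>\<open>5 / 2 * 3 / 10 + 3 / 40 + 1 / 6 < 1\<close>\<close>
    ultimately show ?thesis
      using budget \<epsilon> by linarith
  next
    case False
    then have "12 * (L + L2bar) * D^3 < \<epsilon>"
      by simp
    note case2 = case2[OF this]
    have N: "N = 1"
      using case2 by (rule conjunct1)
    have "iterate_level_bound2 \<epsilon> D L L1bar L2bar \<le> ereal D"
      unfolding iterate_level_bound2_def by (rule Min_le; blast)
    with conjunct2[OF case2] have "ereal dx \<le> ereal D"
      by (rule order_trans)
    then have dx': "dx \<le> D"
      by (simp only: ereal_less_eq)
    have "\<gamma> = sqrt 6 / (6 * D)"
      by (simp add: \<gamma> N)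
    then have budget: "S (2 * D) \<le> \<epsilon>"
      unfolding S_def using False by (intro large_accuracy_budget \<epsilon> D0 M0 \<delta>0 \<delta>1(2) \<delta>2(2)) auto
    have "e 1 \<le> e 0 + S dx"
      using step[of 0 0] \<epsilon> by simp
    also have "S dx \<le> S (2 * D)"
      using dx0 dx' D0 by (intro S_mono) auto
    finally have "e 1 \<le> e 0 + \<epsilon>"
      using budget by linarith
    then have "e 2 \<le> S (D + dx)"
      using step[of 1 1] by (simp add: N numeral_2_eq_2)
    also have "S (D + dx) \<le> S (2 * D)"
      using dx0 dx' D0 by (intro S_mono) auto
    finally show ?thesis
      using budget by (simp add: N numeral_2_eq_2)
  qed
  then show ?thesis
    by (simp add: e_def)
qed

end
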